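(* Let $W:J\times J\to[0,\infty)$ be an $L^2$-graphon, $h_W$ its Cheeger constant, and $\lambda_2(L_W)$ the second smallest eigenvalue of the normalized Laplacian on $W$. Then $$\frac{h_W^2}{4}\le\lambda_2(L_W)\le2h_W.$$
   Context: $J$ is a measure space with finite positive measure (written $dx$), $\mathcal{B}$ its sigma-algebra; an $L^2$-graphon is a symmetric measurable $W:J\times J\to[0,\infty)$ in $L^2(J\times J)$. $\deg(x)=\int_JW(x,y)\,dy$, $\mathrm{vol}(S)=\int_S\deg(x)\,dx$, $\mathrm{cut}(S)=2\int_S\int_{J\setminus S}W(x,y)\,dx\,dy$. The Cheeger constant (conductance) is $$h_W=\inf_{S\in\mathcal{B}:\,\mathrm{vol}(S)\mathrm{vol}(J\setminus S)>0}\frac{\mathrm{cut}(S)}{\min\{\mathrm{vol}(S),\mathrm{vol}(J\setminus S)\}}.$$ The normalization of the Laplacian is such that $$\lambda_2(L_W)=\inf_{f}\frac{\int_J\int_JW(x,y)|f(x)-f(y)|^2\,dx\,dy}{\min_{t\in\mathbb{R}}\int_J\deg(x)|f(x)-t|^2\,dx},$$ the infimum being over bounded measurable nonconstant $f:J\to\mathbb{R}$ with positive denominator. *)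

theory Defs
  imports "HOL-Analysis.Analysis"
begin

definition L2_graphon :: "'a measure \<Rightarrow> ('a \<Rightarrow> 'a \<Rightarrow> real) \<Rightarrow> bool" where
  "L2_graphon M W \<longleftrightarrow>
     (\<lambda>(x, y). W x y) \<in> borel_measurable (M \<Otimes>\<^sub>M M) \<and>
     (\<forall>x\<in>space M. \<forall>y\<in>space M. 0 \<le> W x y) \<and>
     (\<forall>x\<in>space M. \<forall>y\<in>space M. W x y = W y x) \<and>
     integrable (M \<Otimes>\<^sub>M M) (\<lambda>(x, y). (W x y)\<^sup>2)"

text \<open>On a finite measure space an \<open>L\<^sup>2\<close>-graphon is integrable, so \<open>W x\<close> is integrable for almost
  every \<open>x\<close>; on the exceptional null set the Bochner integral below takes the junk value 0, which
  affects none of the integrals over \<open>x\<close>.\<close>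

definition degree_fun :: "'a measure \<Rightarrow> ('a \<Rightarrow> 'a \<Rightarrow> real) \<Rightarrow> 'a \<Rightarrow> real" where
  "degree_fun M W x = (LINT y|M. W x y)"

definition vol :: "'a measure \<Rightarrow> ('a \<Rightarrow> 'a \<Rightarrow> real) \<Rightarrow> 'a set \<Rightarrow> real" where
  "vol M W S = (LINT x:S|M. degree_fun M W x)"

definition cut :: "'a measure \<Rightarrow> ('a \<Rightarrow> 'a \<Rightarrow> real) \<Rightarrow> 'a set \<Rightarrow> real" where
  "cut M W S = 2 * (LINT x:S|M. LINT y:(space M - S)|M. W x y)"

text \<open>The two infima are taken in \<^typ>\<open>ereal\<close>, so that an infimum over the empty family is
  \<open>\<infinity>\<close>. Both families are empty exactly when the degree measure has no measurable set \<open>S\<close> with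
  \<open>S\<close> and its complement both of positive volume (e.g. for \<open>W = 0\<close>).\<close>

definition cheeger_const :: "'a measure \<Rightarrow> ('a \<Rightarrow> 'a \<Rightarrow> real) \<Rightarrow> ereal" where
  "cheeger_const M W =
     (INF S \<in> {S \<in> sets M. vol M W S * vol M W (space M - S) > 0}.
        ereal (cut M W S / min (vol M W S) (vol M W (space M - S))))"

definition dirichlet_energy :: "'a measure \<Rightarrow> ('a \<Rightarrow> 'a \<Rightarrow> real) \<Rightarrow> ('a \<Rightarrow> real) \<Rightarrow> real" where
  "dirichlet_energy M W f = (LINT x|M. LINT y|M. W x y * \<bar>f x - f y\<bar>\<^sup>2)"

text \<open>The infimum over \<open>t\<close> is a minimum for bounded measurable \<open>f\<close>: the integral is a
  quadratic polynomial in \<open>t\<close> whose leading coefficient is the total volume.\<close>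

definition degree_variance :: "'a measure \<Rightarrow> ('a \<Rightarrow> 'a \<Rightarrow> real) \<Rightarrow> ('a \<Rightarrow> real) \<Rightarrow> real" where
  "degree_variance M W f = (INF t::real. LINT x|M. degree_fun M W x * \<bar>f x - t\<bar>\<^sup>2)"

text \<open>The second smallest eigenvalue of the normalized Laplacian, given by its variational formula.
  In this normalization the energy is the full double integral, without a factor 1/2.\<close>

definition lambda2 :: "'a measure \<Rightarrow> ('a \<Rightarrow> 'a \<Rightarrow> real) \<Rightarrow> ereal" where
  "lambda2 M W =
     (INF f \<in> {f \<in> borel_measurable M. bounded (f ` space M) \<and> \<not> f constant_on space M \<and>
                 degree_variance M W f > 0}.
        ereal (dirichlet_energy M W f / degree_variance M W f))"

end

theory Submission imports Defs begin

text \<open>The upper bound tests \<open>\<lambda>\<^sub>2\<close> against indicator functions. For the lower bound, subtract from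
  \<open>f\<close> a median with respect to the degree measure to get \<open>g\<close>, and apply the coarea formula to
  \<open>\<phi> = g \<bar>g\<bar>\<close>, whose superlevel sets then have their smaller side away from \<open>{\<phi> = 0}\<close>. This gives
  \<open>h \<integral> deg g\<^sup>2 \<le> \<integral>\<integral> W \<bar>\<phi>(x) - \<phi>(y)\<bar>\<close>, and the right-hand side is at most
  \<open>\<integral>\<integral> W \<bar>g(x) - g(y)\<bar> (\<bar>g(x)\<bar> + \<bar>g(y)\<bar>)\<close>. Splitting that product by AM-GM, with weights
  \<open>2/h\<close> and \<open>h/8\<close>, lets half of the left-hand side absorb the \<open>g\<^sup>2\<close> terms.\<close>

section \<open>Medians of bounded functions under a finite measure\<close>

text \<open>Take \<open>t\<close> as the infimum of the levels whose strict superlevel set carries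
  at most half of the mass. Levels on either side of \<open>t\<close> satisfy half-mass bounds, and
  continuity from below carries these over to the strict sets at \<open>t\<close> itself.\<close>

lemma (in finite_measure) median:
  fixes f :: "'a \<Rightarrow> real"
  assumes [measurable]: "f \<in> borel_measurable M" and B: "\<And>x. x \<in> space M \<Longrightarrow> \<bar>f x\<bar> \<le> B"
  obtains t where "measure M {x \<in> space M. t < f x} \<le> measure M (space M) / 2"
    and "measure M {x \<in> space M. f x < t} \<le> measure M (space M) / 2"
proof -
  let ?V = "\<lambda>s. measure M {x \<in> space M. s < f x}"
  let ?U = "\<lambda>s. measure M {x \<in> space M. f x \<le> s}"
  let ?T = "measure M (space M)"
  have VU: "?U s = ?T - ?V s" for s
  proof -
    have "{x \<in> space M. f x \<le> s} = space M - {x \<in> space M. s < f x}" by auto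
    then show ?thesis by (simp add: finite_measure_compl)
  qed
  \<comment> \<open>The cutoff \<open>- B - 1\<close> keeps \<open>A\<close> bounded below even when
    the total mass is 0, where every level satisfies the second condition.\<close>
  define A where "A = {s. - B - 1 \<le> s \<and> ?V s \<le> ?T / 2}"
  define t where "t = Inf A"
  \<comment> \<open>On an empty space \<open>B\<close> may be so negative that it lies below the
    cutoff, hence the \<open>max\<close>.\<close>
  have "max B (- B - 1) \<in> A"
  proof -
    have "{x \<in> space M. max B (- B - 1) < f x} = {}" using B by force
    then have "?V (max B (- B - 1)) = 0" by (simp only: measure_empty)
    then show ?thesis by (simp add: A_def del: max_less_iff_conj)
  qed
  then have ne: "A \<noteq> {}" by blast
  have bdd: "bdd_below A" by (auto simp: A_def intro: bdd_belowI[where m = "- B - 1"])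
  have right: "?V s \<le> ?T / 2" if "t < s" for s
  proof -
    obtain a where a: "a \<in> A" "a < s"
      using cInf_lessD[OF ne, of s] \<open>t < s\<close> unfolding t_def by metis
    have "?V s \<le> ?V a"
      using a by (intro finite_measure_mono) auto
    with a show ?thesis by (simp add: A_def)
  qed
  \<comment> \<open>A level below \<open>t\<close> is outside \<open>A\<close>: either its
    superlevel set carries more than half of the mass, or it lies below the cutoff, where its
    sublevel set is empty.\<close>
  have left: "?U s \<le> ?T / 2" if "s < t" for s
  proof (cases "- B - 1 \<le> s")
    case True
    have "s \<notin> A" using that cInf_lower[OF _ bdd, of s] by (auto simp: t_def)
    with True VU[of s] show ?thesis by (simp add: A_def)
  next
    case False
    then have "{x \<in> space M. f x \<le> s} = {}" using B by force
    then have "?U s = 0" by (simp only: measure_empty)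
    then show ?thesis by simp
  qed
  have "(\<Union>n. {x \<in> space M. t + 1 / Suc n < f x}) = {x \<in> space M. t < f x}"
  proof (intro set_eqI iffI)
    fix x assume x: "x \<in> {x \<in> space M. t < f x}"
    then obtain n where "inverse (Suc n) < f x - t"
      using reals_Archimedean[of "f x - t"] by auto
    with x show "x \<in> (\<Union>n. {x \<in> space M. t + 1 / Suc n < f x})"
      by (auto simp: field_simps intro!: exI[of _ n])
  next
    fix x assume "x \<in> (\<Union>n. {x \<in> space M. t + 1 / Suc n < f x})"
    then obtain n where "x \<in> space M" and n: "t + 1 / Suc n < f x" by auto
    have "0 < 1 / real (Suc n)" by simp
    with n have "t < f x" by linarith
    with \<open>x \<in> space M\<close> show "x \<in> {x \<in> space M. t < f x}" by simp
  qed
  moreover have "incseq (\<lambda>n. {x \<in> space M. t + 1 / Suc n < f x})"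
  proof (rule monoI, clarify)
    fix m n :: nat and x assume "m \<le> n" "t + 1 / Suc m < f x"
    moreover have "1 / real (Suc n) \<le> 1 / Suc m" using \<open>m \<le> n\<close> by (intro divide_left_mono) auto
    ultimately show "t + 1 / Suc n < f x" by linarith
  qed
  ultimately have "(\<lambda>n. ?V (t + 1 / Suc n)) \<longlonglongrightarrow> ?V t"
    using finite_Lim_measure_incseq[of "\<lambda>n. {x \<in> space M. t + 1 / Suc n < f x}"] by (simp add: image_subset_iff del: of_nat_Suc)
  then have 1: "?V t \<le> ?T / 2"
    by (rule LIMSEQ_le_const2) (intro exI[of _ 0] allI impI right, simp)
  have "(\<Union>n. {x \<in> space M. f x \<le> t - 1 / Suc n}) = {x \<in> space M. f x < t}"
  proof (intro set_eqI iffI)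
    fix x assume x: "x \<in> {x \<in> space M. f x < t}"
    then obtain n where "inverse (Suc n) < t - f x"
      using reals_Archimedean[of "t - f x"] by auto
    with x show "x \<in> (\<Union>n. {x \<in> space M. f x \<le> t - 1 / Suc n})"
      by (auto simp: field_simps intro!: exI[of _ n])
  next
    fix x assume "x \<in> (\<Union>n. {x \<in> space M. f x \<le> t - 1 / Suc n})"
    then obtain n where "x \<in> space M" and n: "f x \<le> t - 1 / Suc n" by auto
    have "0 < 1 / real (Suc n)" by simp
    with n have "f x < t" by linarith
    with \<open>x \<in> space M\<close> show "x \<in> {x \<in> space M. f x < t}" by simp
  qed
  moreover have "incseq (\<lambda>n. {x \<in> space M. f x \<le> t - 1 / Suc n})"
  proof (rule monoI, clarify)
    fix m n :: nat and x assume "m \<le> n" "f x \<le> t - 1 / Suc m"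
    moreover have "1 / real (Suc n) \<le> 1 / Suc m" using \<open>m \<le> n\<close> by (intro divide_left_mono) auto
    ultimately show "f x \<le> t - 1 / Suc n" by linarith
  qed
  ultimately have "(\<lambda>n. ?U (t - 1 / Suc n)) \<longlonglongrightarrow> measure M {x \<in> space M. f x < t}"
    using finite_Lim_measure_incseq[of "\<lambda>n. {x \<in> space M. f x \<le> t - 1 / Suc n}"] by (simp add: image_subset_iff del: of_nat_Suc)
  then have 2: "measure M {x \<in> space M. f x < t} \<le> ?T / 2"
    by (rule LIMSEQ_le_const2) (intro exI[of _ 0] allI impI left, simp)
  from 1 2 show ?thesis by (rule that)
qed

section \<open>Layer-cake integration over levels\<close>

text \<open>By Tonelli, integrate over \<open>s\<close> first: the interval has length
  \<open>b x - a x\<close>, or 0 if it is empty. The truncation of negative reals by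
  \<open>ennreal\<close> matches the empty case, so no order between \<open>a\<close> and
  \<open>b\<close> has to be assumed.\<close>

lemma (in sigma_finite_measure) nn_integral_layer_cake:
  fixes a b :: "'a \<Rightarrow> real" and k :: "'a \<Rightarrow> ennreal"
  assumes [measurable]: "a \<in> borel_measurable M" "b \<in> borel_measurable M" "k \<in> borel_measurable M"
  shows "(\<integral>\<^sup>+s. \<integral>\<^sup>+x. k x * indicator {a x..<b x} s \<partial>M \<partial>lborel) = (\<integral>\<^sup>+x. k x * ennreal (b x - a x) \<partial>M)"
proof -
  interpret P: pair_sigma_finite M "lborel :: real measure" ..
  \<comment> \<open>The interval depends on \<open>x\<close>; written as two comparisons, its
    indicator is visibly jointly measurable.\<close>
  have "(\<lambda>(x, s). k x * indicator {a x..<b x} s)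
      = (\<lambda>p. k (fst p) * (if a (fst p) \<le> snd p \<and> snd p < b (fst p) then 1 else 0))"
    by (auto simp: fun_eq_iff indicator_def)
  also have "\<dots> \<in> borel_measurable (M \<Otimes>\<^sub>M lborel)" by measurable
  finally have "(\<integral>\<^sup>+s. \<integral>\<^sup>+x. k x * indicator {a x..<b x} s \<partial>M \<partial>lborel)
      = (\<integral>\<^sup>+x. \<integral>\<^sup>+s. k x * indicator {a x..<b x} s \<partial>lborel \<partial>M)"
    by (rule P.Fubini')
  also have "\<dots> = (\<integral>\<^sup>+x. k x * ennreal (b x - a x) \<partial>M)"
  proof (rule nn_integral_cong)
    fix x
    show "(\<integral>\<^sup>+s. k x * indicator {a x..<b x} s \<partial>lborel) = k x * ennreal (b x - a x)"
      by (cases "a x \<le> b x") (simp_all add: nn_integral_cmult ennreal_neg)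
  qed
  finally show ?thesis .
qed

text \<open>Needed to move constant factors through the outer integral over levels.\<close>

lemma (in sigma_finite_measure) borel_measurable_layer:
  fixes a b :: "'a \<Rightarrow> real" and k :: "'a \<Rightarrow> ennreal"
  assumes [measurable]: "a \<in> borel_measurable M" "b \<in> borel_measurable M" "k \<in> borel_measurable M"
  shows "(\<lambda>s. \<integral>\<^sup>+x. k x * indicator {a x..<b x} s \<partial>M) \<in> borel_measurable lborel"
proof -
  have "(\<lambda>s. \<integral>\<^sup>+x. k x * indicator {a x..<b x} s \<partial>M)
      = (\<lambda>s. \<integral>\<^sup>+x. k x * (if a x \<le> s \<and> s < b x then 1 else 0) \<partial>M)"
    by (simp add: indicator_def of_bool_def)
  also have "\<dots> \<in> borel_measurable lborel" by measurable
  finally show ?thesis .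
qed

section \<open>Elementary real inequalities\<close>

lemma power2_diff_le:
  fixes x y B :: real
  assumes "\<bar>x\<bar> \<le> B" "\<bar>y\<bar> \<le> B"
  shows "\<bar>x - y\<bar>\<^sup>2 \<le> (B + B)\<^sup>2"
  by (rule power_mono) (use assms in auto)

text \<open>For arguments of equal sign this is an equality. For opposite signs the left side is
  \<open>x^2 + y^2\<close>, while \<open>\<bar>x - y\<bar> = \<bar>x\<bar> + \<bar>y\<bar>\<close>
  makes the right side the square of that sum.\<close>

lemma abs_diff_mult_abs_le:
  fixes x y :: real
  shows "\<bar>x * \<bar>x\<bar> - y * \<bar>y\<bar>\<bar> \<le> \<bar>x - y\<bar> * (\<bar>x\<bar> + \<bar>y\<bar>)"
proof -
  have same: "x * \<bar>x\<bar> - y * \<bar>y\<bar> = (x - y) * (\<bar>x\<bar> + \<bar>y\<bar>)" if "0 \<le> x * y"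
    using that by (auto simp: zero_le_mult_iff algebra_simps)
  have *: "\<bar>x * \<bar>x\<bar> - y * \<bar>y\<bar>\<bar> = x\<^sup>2 + y\<^sup>2 \<and> \<bar>x - y\<bar> = \<bar>x\<bar> + \<bar>y\<bar>" if "x * y < 0"
  proof -
    have "\<bar>x * x + y * y\<bar> = x * x + y * y" "\<bar>- (x * x) - y * y\<bar> = x * x + y * y"
      using sum_squares_ge_zero[of x y] by linarith+
    with that show ?thesis
      by (auto simp: mult_less_0_iff power2_eq_square)
  qed
  show ?thesis
  proof (cases "0 \<le> x * y")
    case False
    then have "\<bar>x * \<bar>x\<bar> - y * \<bar>y\<bar>\<bar> = x\<^sup>2 + y\<^sup>2" "\<bar>x - y\<bar> = \<bar>x\<bar> + \<bar>y\<bar>"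
      using * by (simp_all only: not_le)
    moreover have "x\<^sup>2 + y\<^sup>2 \<le> (\<bar>x\<bar> + \<bar>y\<bar>) * (\<bar>x\<bar> + \<bar>y\<bar>)"
      by (simp add: power2_eq_square algebra_simps)
    ultimately show ?thesis by simp
  next
    case True
    then show ?thesis by (simp add: same abs_mult)
  qed
qed

section \<open>Integration against the graphon weight and its degree function\<close>

locale graphon = finite_measure M for M :: "'a measure" +
  fixes W :: "'a \<Rightarrow> 'a \<Rightarrow> real"
  assumes graphon: "L2_graphon M W"
begin

sublocale pair: pair_sigma_finite M M ..

sublocale prod: finite_measure "M \<Otimes>\<^sub>M M"
  by (rule finite_measure_pair_measure) (unfold_locales)

definition wt :: "'a \<times> 'a \<Rightarrow> real" where
  "wt p = W (fst p) (snd p)"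

abbreviation deg :: "'a \<Rightarrow> real" where
  "deg \<equiv> degree_fun M W"

lemma wt_measurable [measurable]: "wt \<in> borel_measurable (M \<Otimes>\<^sub>M M)"
  using graphon by (simp add: L2_graphon_def wt_def[abs_def] case_prod_beta')

lemma wt_nonneg: "p \<in> space (M \<Otimes>\<^sub>M M) \<Longrightarrow> 0 \<le> wt p"
  using graphon by (auto simp: L2_graphon_def wt_def space_pair_measure)

lemma wt_swap: "p \<in> space (M \<Otimes>\<^sub>M M) \<Longrightarrow> wt (prod.swap p) = wt p"
  using graphon by (auto simp: L2_graphon_def wt_def space_pair_measure)

text \<open>The product measure is finite, so square integrability gives integrability through the
  pointwise bound \<open>\<bar>w\<bar> <= 1 + w^2\<close>.\<close>

lemma integrable_wt: "integrable (M \<Otimes>\<^sub>M M) wt"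
proof (rule Bochner_Integration.integrable_bound)
  show "integrable (M \<Otimes>\<^sub>M M) (\<lambda>p. 1 + (wt p)\<^sup>2)"
    using graphon by (simp add: L2_graphon_def wt_def case_prod_beta')
  show "AE p in M \<Otimes>\<^sub>M M. norm (wt p) \<le> norm (1 + (wt p)\<^sup>2)"
  proof (rule AE_I2)
    fix p
    have "0 \<le> (\<bar>wt p\<bar> - 1)\<^sup>2" by simp
    then have "2 * \<bar>wt p\<bar> \<le> 1 + (wt p)\<^sup>2" by (simp add: power2_diff)
    then show "norm (wt p) \<le> norm (1 + (wt p)\<^sup>2)" by simp
  qed
qed simp

lemma integrable_wt_mult:
  assumes [measurable]: "k \<in> borel_measurable (M \<Otimes>\<^sub>M M)"
    and B: "\<And>p. p \<in> space (M \<Otimes>\<^sub>M M) \<Longrightarrow> \<bar>k p\<bar> \<le> B"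
  shows "integrable (M \<Otimes>\<^sub>M M) (\<lambda>p. wt p * k p)"
proof (rule Bochner_Integration.integrable_bound)
  show "integrable (M \<Otimes>\<^sub>M M) (\<lambda>p. wt p * B)"
    using integrable_wt by simp
  show "AE p in M \<Otimes>\<^sub>M M. norm (wt p * k p) \<le> norm (wt p * B)"
  proof (rule AE_I2)
    fix p assume "p \<in> space (M \<Otimes>\<^sub>M M)"
    with B[of p] have "\<bar>k p\<bar> \<le> \<bar>B\<bar>" by simp
    then show "norm (wt p * k p) \<le> norm (wt p * B)"
      by (simp add: abs_mult mult_left_mono)
  qed
qed simp

lemma deg_measurable [measurable]: "deg \<in> borel_measurable M"
proof -
  have "(\<lambda>x. LINT y|M. wt (x, y)) \<in> borel_measurable M" by measurable
  then show ?thesis by (simp add: degree_fun_def[abs_def] wt_def)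
qed

lemma deg_nonneg: "x \<in> space M \<Longrightarrow> 0 \<le> deg x"
  using graphon by (auto simp: L2_graphon_def degree_fun_def intro!: Bochner_Integration.integral_nonneg)

lemma iterated_wt_mult:
  assumes "k \<in> borel_measurable (M \<Otimes>\<^sub>M M)"
    and "\<And>p. p \<in> space (M \<Otimes>\<^sub>M M) \<Longrightarrow> \<bar>k p\<bar> \<le> B"
  shows "(LINT x|M. LINT y|M. W x y * k (x, y)) = (LINT p|(M \<Otimes>\<^sub>M M). wt p * k p)"
  using pair.integral_fst'[OF integrable_wt_mult[OF assms]] by (simp add: wt_def)

lemma integrable_deg_mult:
  assumes "u \<in> borel_measurable M"
    and "\<And>x. x \<in> space M \<Longrightarrow> \<bar>u x\<bar> \<le> B"
  shows "integrable M (\<lambda>x. deg x * u x)"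
proof -
  have "integrable (M \<Otimes>\<^sub>M M) (\<lambda>p. wt p * u (fst p))"
    using assms by (intro integrable_wt_mult[where B = B]) (auto simp: space_pair_measure)
  from pair.integrable_fst'[OF this] show ?thesis
    by (simp add: wt_def degree_fun_def)
qed

lemma integral_deg_fst:
  assumes "u \<in> borel_measurable M"
    and "\<And>x. x \<in> space M \<Longrightarrow> \<bar>u x\<bar> \<le> B"
  shows "(LINT p|(M \<Otimes>\<^sub>M M). wt p * u (fst p)) = (LINT x|M. deg x * u x)"
  using iterated_wt_mult[of "\<lambda>p. u (fst p)" B] assms
  by (auto simp: space_pair_measure degree_fun_def)

text \<open>Swapping coordinates preserves both the product measure and \<open>W\<close>. This
  identifies the two orientations of a cut and the two marginals of the weight.\<close>

lemma integral_wt_swap: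
  assumes [measurable]: "k \<in> borel_measurable (M \<Otimes>\<^sub>M M)"
  shows "(LINT p|(M \<Otimes>\<^sub>M M). wt p * k (prod.swap p)) = (LINT p|(M \<Otimes>\<^sub>M M). wt p * k p)"
proof -
  have "(LINT p|(M \<Otimes>\<^sub>M M). wt p * k p) = (LINT p|(M \<Otimes>\<^sub>M M). wt (prod.swap p) * k (prod.swap p))"
    using pair.integral_product_swap[of "\<lambda>p. wt p * k p"]
    by (simp add: case_prod_beta' prod.swap_def)
  also have "\<dots> = (LINT p|(M \<Otimes>\<^sub>M M). wt p * k (prod.swap p))"
    by (intro Bochner_Integration.integral_cong) (auto simp: wt_swap)
  finally show ?thesis by simp
qed

lemma integral_deg_snd:
  assumes [measurable]: "u \<in> borel_measurable M"
    and "\<And>x. x \<in> space M \<Longrightarrow> \<bar>u x\<bar> \<le> B"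
  shows "(LINT p|(M \<Otimes>\<^sub>M M). wt p * u (snd p)) = (LINT x|M. deg x * u x)"
  using integral_wt_swap[of "\<lambda>p. u (fst p)"] integral_deg_fst[OF assms] by simp

section \<open>Volume, cut and energy as integrals\<close>

lemma vol_eq: "vol M W S = (LINT x|M. deg x * indicator S x)"
  by (simp add: vol_def set_lebesgue_integral_def mult.commute)

lemma cut_eq:
  assumes [measurable]: "S \<in> sets M"
  shows "cut M W S = 2 * (LINT p|(M \<Otimes>\<^sub>M M). wt p * (indicator S (fst p) * indicator (space M - S) (snd p)))"
proof -
  have "cut M W S = 2 * (LINT x|M. LINT y|M. W x y * (indicator S x * indicator (space M - S) y))"
    unfolding cut_def set_lebesgue_integral_def
    by (simp add: mult_ac flip: integral_mult_right_zero)
  also have "(LINT x|M. LINT y|M. W x y * (indicator S x * indicator (space M - S) y))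
     = (LINT p|(M \<Otimes>\<^sub>M M). wt p * (indicator S (fst p) * indicator (space M - S) (snd p)))"
    by (subst iterated_wt_mult[where B = 1, symmetric]) (auto simp: indicator_def)
  finally show ?thesis .
qed

lemma energy_eq:
  assumes [measurable]: "f \<in> borel_measurable M" and B: "\<And>x. x \<in> space M \<Longrightarrow> \<bar>f x\<bar> \<le> B"
  shows "dirichlet_energy M W f = (LINT p|(M \<Otimes>\<^sub>M M). wt p * \<bar>f (fst p) - f (snd p)\<bar>\<^sup>2)"
proof -
  have "\<bar>f (fst p) - f (snd p)\<bar>\<^sup>2 \<le> (B + B)\<^sup>2" if "p \<in> space (M \<Otimes>\<^sub>M M)" for p
    using B[of "fst p"] B[of "snd p"] that
    by (intro power2_diff_le) (auto simp: space_pair_measure)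
  then show ?thesis
    unfolding dirichlet_energy_def
    by (subst iterated_wt_mult[where B = "(B+B)\<^sup>2", symmetric]) auto
qed

lemma vol_nonneg: "S \<in> sets M \<Longrightarrow> 0 \<le> vol M W S"
  unfolding vol_eq using deg_nonneg by (auto intro!: Bochner_Integration.integral_nonneg)

lemma cut_nonneg: "S \<in> sets M \<Longrightarrow> 0 \<le> cut M W S"
  unfolding cut_eq using wt_nonneg by (auto intro!: Bochner_Integration.integral_nonneg)

text \<open>The squared difference of an indicator is 1 exactly on pairs separated by
  \<open>S\<close>. These come in two orientations of equal weight, which accounts for the factor 2
  in \<open>cut\<close>.\<close>

lemma energy_indicator:
  assumes [measurable]: "S \<in> sets M"
  shows "dirichlet_energy M W (indicator S) = cut M W S"
proof -
  let ?k = "\<lambda>p. indicator S (fst p) * indicator (space M - S) (snd p) :: real"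
  have int: "integrable (M \<Otimes>\<^sub>M M) (\<lambda>p. wt p * ?k p)"
    "integrable (M \<Otimes>\<^sub>M M) (\<lambda>p. wt p * ?k (prod.swap p))"
    by (rule integrable_wt_mult[where B = 1]; simp add: indicator_def)+
  have "dirichlet_energy M W (indicator S)
      = (LINT p|(M \<Otimes>\<^sub>M M). wt p * \<bar>indicator S (fst p) - indicator S (snd p)\<bar>\<^sup>2)"
    by (rule energy_eq[where B = 1]) auto
  also have "\<dots> = (LINT p|(M \<Otimes>\<^sub>M M). wt p * ?k p + wt p * ?k (prod.swap p))"
    by (intro Bochner_Integration.integral_cong) (auto simp: indicator_def space_pair_measure)
  also have "\<dots> = cut M W S"
    using int by (simp add: integral_wt_swap[of ?k] cut_eq del: fst_swap snd_swap)
  finally show ?thesis .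
qed

section \<open>Upper bound by indicator test functions\<close>

lemma degree_variance_le:
  "degree_variance M W f \<le> (LINT x|M. deg x * \<bar>f x - t\<bar>\<^sup>2)"
  unfolding degree_variance_def
  by (rule cINF_lower) (auto intro!: bdd_belowI[where m = 0] Bochner_Integration.integral_nonneg mult_nonneg_nonneg deg_nonneg)

text \<open>With \<open>a\<close> and \<open>b\<close> the two volumes and \<open>m\<close> their
  minimum, the integral at \<open>t\<close> is
  \<open>(1 - t)^2 a + t^2 b >= m ((1 - t)^2 + t^2)\<close>, and the last factor is at least 1/2,
  its value at \<open>t = 1/2\<close>. This 1/2 is the source of the 2 in the upper bound.\<close>

lemma degree_variance_indicator:
  assumes [measurable]: "S \<in> sets M"
  shows "min (vol M W S) (vol M W (space M - S)) / 2 \<le> degree_variance M W (indicator S)"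
  unfolding degree_variance_def
proof (rule cINF_greatest)
  fix t :: real
  let ?a = "vol M W S" and ?b = "vol M W (space M - S)"
  let ?m = "min ?a ?b"
  have int: "integrable M (\<lambda>x. deg x * (indicator T x :: real))" if "T \<in> sets M" for T
    using that by (intro integrable_deg_mult[where B = 1]) auto
  have "(LINT x|M. deg x * \<bar>indicator S x - t\<bar>\<^sup>2)
      = (LINT x|M. (1 - t)\<^sup>2 * (deg x * indicator S x) + t\<^sup>2 * (deg x * indicator (space M - S) x))"
    by (intro Bochner_Integration.integral_cong) (auto simp: indicator_def)
  also have "\<dots> = (1 - t)\<^sup>2 * ?a + t\<^sup>2 * ?b"
    using int[of S] int[of "space M - S"] by (simp add: vol_eq)
  also have "\<dots> \<ge> (1 - t)\<^sup>2 * ?m + t\<^sup>2 * ?m"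
    by (intro add_mono mult_left_mono) auto
  moreover have "(1 - t)\<^sup>2 * ?m + t\<^sup>2 * ?m = ?m / 2 + 2 * (t - 1/2)\<^sup>2 * ?m"
    by (simp add: power2_eq_square algebra_simps)
  moreover have "0 \<le> 2 * (t - 1/2)\<^sup>2 * ?m"
    using vol_nonneg[of S] vol_nonneg[of "space M - S"] by simp
  ultimately show "?m / 2 \<le> (LINT x|M. deg x * \<bar>indicator S x - t\<bar>\<^sup>2)"
    by linarith
qed simp

lemma lambda2_le: "lambda2 M W \<le> 2 * cheeger_const M W"
proof -
  \<comment> \<open>With the 2 moved to the left, it suffices to bound every quotient of the
    infimum, which also covers an empty family.\<close>
  have "lambda2 M W / 2 \<le> cheeger_const M W"
    unfolding cheeger_const_def
  proof (rule INF_greatest, clarify)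
    fix S assume [measurable]: "S \<in> sets M" and pos: "0 < vol M W S * vol M W (space M - S)"
    let ?m = "min (vol M W S) (vol M W (space M - S))"
    let ?f = "indicator S :: 'a \<Rightarrow> real"
    have m: "0 < ?m"
      using pos vol_nonneg[of S] vol_nonneg[of "space M - S"]
      by (auto simp: zero_less_mult_iff)
    \<comment> \<open>Positive volume makes both sides of the cut nonempty, so the indicator is not
      constant.\<close>
    have "T \<noteq> {}" if "0 < vol M W T" for T
      using that by (auto simp: vol_def set_lebesgue_integral_def)
    then have "S \<noteq> {}" "space M - S \<noteq> {}"
      using m by (metis min_less_iff_conj)+
    then obtain x y where "x \<in> S" "y \<in> space M - S" by blast
    moreover have "x \<in> space M"
      using \<open>x \<in> S\<close> sets.sets_into_space[of S M] by auto
    ultimately have "?f x \<noteq> ?f y" "x \<in> space M" "y \<in> space M" by auto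
    then have nc: "\<not> ?f constant_on space M"
      unfolding constant_on_def by metis
    have var: "?m / 2 \<le> degree_variance M W ?f"
      by (rule degree_variance_indicator) simp
    have "bounded (?f ` space M)"
      by (rule boundedI[where B = 1]) auto
    with nc var m have "lambda2 M W \<le> ereal (dirichlet_energy M W ?f / degree_variance M W ?f)"
      unfolding lambda2_def by (intro INF_lower) auto
    also have "\<dots> = ereal (cut M W S / degree_variance M W ?f)"
      by (simp add: energy_indicator)
    also have "\<dots> \<le> ereal (cut M W S / (?m / 2))"
    proof -
      have "0 < degree_variance M W ?f * (?m / 2)"
        using var m by (intro mult_pos_pos) linarith+
      with var show ?thesis
        unfolding ereal_less_eq by (intro divide_left_mono cut_nonneg) auto
    qed
    also have "\<dots> = 2 * ereal (cut M W S / ?m)"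
      by (simp add: field_simps)
    finally show "lambda2 M W / 2 \<le> ereal (cut M W S / ?m)"
      by (simp add: ereal_divide_le_pos)
  qed
  then show ?thesis by (simp add: ereal_divide_le_pos)
qed

section \<open>Volume as a finite measure\<close>

text \<open>Realizes \<open>vol\<close> as a measure, so that medians, complements and monotonicity
  for volumes come from \<open>finite_measure\<close>.\<close>

definition deg_measure :: "'a measure" where
  "deg_measure = density M (\<lambda>x. ennreal (deg x))"

lemma nn_integral_vol:
  assumes [measurable]: "S \<in> sets M"
  shows "(\<integral>\<^sup>+x. ennreal (deg x) * indicator S x \<partial>M) = ennreal (vol M W S)"
proof -
  have "(\<integral>\<^sup>+x. ennreal (deg x) * indicator S x \<partial>M) = (\<integral>\<^sup>+x. ennreal (deg x * indicator S x) \<partial>M)"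
    by (intro nn_integral_cong) (simp add: indicator_def)
  also have "\<dots> = ennreal (vol M W S)"
    unfolding vol_eq
    by (intro nn_integral_eq_integral integrable_deg_mult[where B = 1] AE_I2) (auto simp: deg_nonneg)
  finally show ?thesis .
qed

lemma emeasure_deg_measure: "S \<in> sets M \<Longrightarrow> emeasure deg_measure S = ennreal (vol M W S)"
  by (simp add: deg_measure_def emeasure_density nn_integral_vol)

lemma measure_deg_measure: "S \<in> sets M \<Longrightarrow> measure deg_measure S = vol M W S"
  by (simp add: measure_def emeasure_deg_measure vol_nonneg)

lemma space_deg_measure [simp]: "space deg_measure = space M"
  and sets_deg_measure [measurable_cong, simp]: "sets deg_measure = sets M"
  by (simp_all add: deg_measure_def)

sublocale deg: finite_measure deg_measure
  by (rule finite_measureI) (simp add: emeasure_deg_measure)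

lemma vol_compl: "S \<in> sets M \<Longrightarrow> vol M W (space M - S) = vol M W (space M) - vol M W S"
  using deg.finite_measure_compl[of S] by (simp add: measure_deg_measure)

lemma vol_mono: "S \<subseteq> T \<Longrightarrow> S \<in> sets M \<Longrightarrow> T \<in> sets M \<Longrightarrow> vol M W S \<le> vol M W T"
  using deg.finite_measure_mono[of S T] by (simp add: measure_deg_measure)

section \<open>Coarea inequality\<close>

lemma nn_integral_cut:
  assumes [measurable]: "S \<in> sets M"
  shows "2 * (\<integral>\<^sup>+p. ennreal (wt p) * (indicator S (fst p) * indicator (space M - S) (snd p)) \<partial>(M \<Otimes>\<^sub>M M))
    = ennreal (cut M W S)"
proof -
  let ?k = "\<lambda>p. indicator S (fst p) * indicator (space M - S) (snd p)"
  have "(\<integral>\<^sup>+p. ennreal (wt p) * ?k p \<partial>(M \<Otimes>\<^sub>M M)) = (\<integral>\<^sup>+p. ennreal (wt p * ?k p) \<partial>(M \<Otimes>\<^sub>M M))"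
    by (intro nn_integral_cong) (simp add: indicator_def)
  also have "\<dots> = ennreal (LINT p|(M \<Otimes>\<^sub>M M). wt p * ?k p)"
    by (intro nn_integral_eq_integral integrable_wt_mult[where B = 1] AE_I2)
      (auto simp: wt_nonneg indicator_def)
  finally show ?thesis
    by (simp add: cut_eq ennreal_mult')
qed

text \<open>The last two hypotheses say that 0 is a median of \<open>f\<close> for volume. Integrate
  the isoperimetric bound for \<open>{s < f}\<close> over all levels \<open>s\<close>: the smaller
  volumes integrate to the weighted norm of \<open>f\<close>, the cuts to its total
  variation.\<close>

lemma coarea_le:
  assumes [measurable]: "f \<in> borel_measurable M" and B: "\<And>x. x \<in> space M \<Longrightarrow> \<bar>f x\<bar> \<le> B"
    and h: "0 \<le> h" "\<And>S. S \<in> sets M \<Longrightarrow> h * min (vol M W S) (vol M W (space M - S)) \<le> cut M W S"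
    and pos: "vol M W {x \<in> space M. 0 < f x} \<le> vol M W (space M) / 2"
    and neg: "vol M W {x \<in> space M. f x < 0} \<le> vol M W (space M) / 2"
  shows "h * (LINT x|M. deg x * \<bar>f x\<bar>) \<le> (LINT p|(M \<Otimes>\<^sub>M M). wt p * \<bar>f (fst p) - f (snd p)\<bar>)"
proof -
  let ?P = "M \<Otimes>\<^sub>M M"
  let ?d = "\<lambda>p. f (fst p) - f (snd p)"
  let ?k = "\<lambda>p. max 0 (?d p)"
  define S where "S s = {x \<in> space M. s < f x}" for s
  have [measurable]: "S s \<in> sets M" for s by (simp add: S_def)
  have D: "\<bar>?k p\<bar> \<le> 2 * B \<and> \<bar>?k (prod.swap p)\<bar> \<le> 2 * B" if "p \<in> space ?P" for p
    using B[of "fst p"] B[of "snd p"] that by (auto simp: space_pair_measure)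
  \<comment> \<open>The interval on the left contains \<open>s\<close> exactly when \<open>x\<close>
    is on the smaller side of level \<open>s\<close>: \<open>s < f x\<close> for
    \<open>s >= 0\<close>, and \<open>f x <= s\<close> for \<open>s < 0\<close>. On the right,
    \<open>s\<close> separates the pair in one orientation, and the 2 comes from
    \<open>cut\<close>.\<close>
  have level: "ennreal h * (\<integral>\<^sup>+x. ennreal (deg x) * indicator {min 0 (f x)..<max 0 (f x)} s \<partial>M)
      \<le> 2 * (\<integral>\<^sup>+p. ennreal (wt p) * indicator {f (snd p)..<f (fst p)} s \<partial>?P)" for s
  proof -
    have "(\<integral>\<^sup>+x. ennreal (deg x) * indicator {min 0 (f x)..<max 0 (f x)} s \<partial>M)
        = ennreal (min (vol M W (S s)) (vol M W (space M - S s)))"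
    proof (cases "0 \<le> s")
      case True
      have "vol M W (S s) \<le> vol M W {x \<in> space M. 0 < f x}"
        using True by (intro vol_mono) (auto simp: S_def)
      then have "min (vol M W (S s)) (vol M W (space M - S s)) = vol M W (S s)"
        using pos by (simp add: vol_compl)
      moreover have "(\<integral>\<^sup>+x. ennreal (deg x) * indicator {min 0 (f x)..<max 0 (f x)} s \<partial>M)
          = (\<integral>\<^sup>+x. ennreal (deg x) * indicator (S s) x \<partial>M)"
        using True by (intro nn_integral_cong) (auto simp: S_def indicator_def)
      ultimately show ?thesis by (simp add: nn_integral_vol)
    next
      case False
      have "vol M W (space M - S s) \<le> vol M W {x \<in> space M. f x < 0}"
        using False by (intro vol_mono) (auto simp: S_def)
      then have "min (vol M W (S s)) (vol M W (space M - S s)) = vol M W (space M - S s)"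
        using neg by (simp add: vol_compl)
      moreover have "(\<integral>\<^sup>+x. ennreal (deg x) * indicator {min 0 (f x)..<max 0 (f x)} s \<partial>M)
          = (\<integral>\<^sup>+x. ennreal (deg x) * indicator (space M - S s) x \<partial>M)"
        using False by (intro nn_integral_cong) (auto simp: S_def indicator_def)
      ultimately show ?thesis by (simp add: nn_integral_vol)
    qed
    then have "ennreal h * (\<integral>\<^sup>+x. ennreal (deg x) * indicator {min 0 (f x)..<max 0 (f x)} s \<partial>M)
        \<le> ennreal (cut M W (S s))"
      using h by (simp add: ennreal_mult'[symmetric] ennreal_leI)
    also have "\<dots> = 2 * (\<integral>\<^sup>+p. ennreal (wt p) * (indicator (S s) (fst p) * indicator (space M - S s) (snd p)) \<partial>?P)"
      by (simp add: nn_integral_cut)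
    also have "(\<integral>\<^sup>+p. ennreal (wt p) * (indicator (S s) (fst p) * indicator (space M - S s) (snd p)) \<partial>?P)
        = (\<integral>\<^sup>+p. ennreal (wt p) * indicator {f (snd p)..<f (fst p)} s \<partial>?P)"
      by (intro nn_integral_cong) (auto simp: S_def indicator_def space_pair_measure)
    finally show ?thesis .
  qed
  have int: "integrable ?P (\<lambda>p. wt p * ?k p)" "integrable ?P (\<lambda>p. wt p * ?k (prod.swap p))"
    by (rule integrable_wt_mult[where B = "2 * B"]; use D in simp)+
  have "ennreal (h * (LINT x|M. deg x * \<bar>f x\<bar>)) = ennreal h * (\<integral>\<^sup>+x. ennreal (deg x * \<bar>f x\<bar>) \<partial>M)"
    using h B
    by (subst nn_integral_eq_integral)
      (auto simp: ennreal_mult' deg_nonneg intro!: integrable_deg_mult[where B = B] AE_I2)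
  also have "(\<integral>\<^sup>+x. ennreal (deg x * \<bar>f x\<bar>) \<partial>M)
      = (\<integral>\<^sup>+x. ennreal (deg x) * ennreal (max 0 (f x) - min 0 (f x)) \<partial>M)"
    by (intro nn_integral_cong) (auto simp: ennreal_mult' deg_nonneg max_def min_def)
  also have "\<dots> = (\<integral>\<^sup>+s. \<integral>\<^sup>+x. ennreal (deg x) * indicator {min 0 (f x)..<max 0 (f x)} s \<partial>M \<partial>lborel)"
    by (rule nn_integral_layer_cake[symmetric]) measurable
  also have "ennreal h * \<dots> \<le> (\<integral>\<^sup>+s. ennreal h * (\<integral>\<^sup>+x. ennreal (deg x) * indicator {min 0 (f x)..<max 0 (f x)} s \<partial>M) \<partial>lborel)"
    by (rule eq_refl, rule nn_integral_cmult[symmetric], rule borel_measurable_layer) measurable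
  also have "\<dots> \<le> (\<integral>\<^sup>+s. 2 * (\<integral>\<^sup>+p. ennreal (wt p) * indicator {f (snd p)..<f (fst p)} s \<partial>?P) \<partial>lborel)"
    by (intro nn_integral_mono level)
  also have "\<dots> = 2 * (\<integral>\<^sup>+s. \<integral>\<^sup>+p. ennreal (wt p) * indicator {f (snd p)..<f (fst p)} s \<partial>?P \<partial>lborel)"
    by (rule nn_integral_cmult, rule pair.P.borel_measurable_layer) measurable
  also have "(\<integral>\<^sup>+s. \<integral>\<^sup>+p. ennreal (wt p) * indicator {f (snd p)..<f (fst p)} s \<partial>?P \<partial>lborel)
      = (\<integral>\<^sup>+p. ennreal (wt p) * ennreal (?d p) \<partial>?P)"
    by (rule pair.P.nn_integral_layer_cake) measurable
  also have "(\<integral>\<^sup>+p. ennreal (wt p) * ennreal (?d p) \<partial>?P) = (\<integral>\<^sup>+p. ennreal (wt p * ?k p) \<partial>?P)"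
    by (intro nn_integral_cong) (auto simp: ennreal_mult' wt_nonneg max_def ennreal_neg)
  also have "2 * \<dots> = ennreal (2 * (LINT p|?P. wt p * ?k p))"
    using int(1) by (subst nn_integral_eq_integral) (auto simp: ennreal_mult' wt_nonneg)
  \<comment> \<open>One of the two copies of the positive part is swapped, so that together they
    form the absolute difference.\<close>
  also have "2 * (LINT p|?P. wt p * ?k p) = (LINT p|?P. wt p * ?k p + wt p * ?k (prod.swap p))"
    using int by (simp add: integral_wt_swap[of ?k] del: fst_swap snd_swap)
  also have "\<dots> = (LINT p|?P. wt p * \<bar>?d p\<bar>)"
    by (intro Bochner_Integration.integral_cong) (auto simp: max_def)
  finally show ?thesis
    by (subst (asm) ennreal_le_iff) (auto intro!: Bochner_Integration.integral_nonneg simp: wt_nonneg)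
qed

section \<open>Lower bound for the energy\<close>

text \<open>Here \<open>h\<close> is any nonnegative real satisfying the isoperimetric bound, not
  the Cheeger constant itself, so an infinite Cheeger constant can be handled by large values of
  \<open>h\<close>. The case \<open>h = 0\<close> is separate because the weight
  \<open>2 / h\<close> is used.\<close>

lemma energy_ge:
  assumes [measurable]: "f \<in> borel_measurable M" and B: "\<And>x. x \<in> space M \<Longrightarrow> \<bar>f x\<bar> \<le> B"
    and h: "0 \<le> h" "\<And>S. S \<in> sets M \<Longrightarrow> h * min (vol M W S) (vol M W (space M - S)) \<le> cut M W S"
  shows "h\<^sup>2 / 4 * degree_variance M W f \<le> dirichlet_energy M W f"
proof (cases "h = 0")
  case True
  have "0 \<le> dirichlet_energy M W f"
    using energy_eq[OF assms(1) B] by (auto intro!: Bochner_Integration.integral_nonneg simp: wt_nonneg)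
  then show ?thesis using True by simp
next
  case False
  then have hpos: "0 < h" using h by simp
  let ?P = "M \<Otimes>\<^sub>M M"
  obtain t where t: "vol M W {x \<in> space M. t < f x} \<le> vol M W (space M) / 2"
    "vol M W {x \<in> space M. f x < t} \<le> vol M W (space M) / 2"
    using deg.median[of f B] B by (auto simp: measure_deg_measure)
  define g where "g x = f x - t" for x
  have [measurable]: "g \<in> borel_measurable M" by (simp add: g_def[abs_def])
  define C where "C = B + \<bar>t\<bar>"
  have C: "\<bar>g x\<bar> \<le> C" if "x \<in> space M" for x
    using B[OF that] by (auto simp: g_def C_def)
  then have C2: "(g x)\<^sup>2 \<le> C\<^sup>2" if "x \<in> space M" for x
    using that by (force simp: abs_le_square_iff[symmetric])
  have C3: "\<bar>g x * \<bar>g x\<bar>\<bar> \<le> C\<^sup>2" if "x \<in> space M" for x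
    using C2[OF that] by (simp add: abs_mult power2_eq_square)
  define D where "D = (LINT x|M. deg x * (g x)\<^sup>2)"
  let ?E = "dirichlet_energy M W f"
  have dg: "\<bar>g (fst p) - g (snd p)\<bar>\<^sup>2 \<le> (C + C)\<^sup>2" if "p \<in> space ?P" for p
    using C[of "fst p"] C[of "snd p"] that
    by (intro power2_diff_le) (auto simp: space_pair_measure)
  have E: "?E = (LINT p|?P. wt p * \<bar>g (fst p) - g (snd p)\<bar>\<^sup>2)"
    using energy_eq[OF assms(1) B] by (simp add: g_def)
  \<comment> \<open>The signed square keeps the sign of \<open>g\<close>, so the median property of
    \<open>t\<close> makes 0 a median of \<open>g \<bar>g\<bar>\<close>.\<close>
  have sgn: "0 < g x * \<bar>g x\<bar> \<longleftrightarrow> t < f x" "g x * \<bar>g x\<bar> < 0 \<longleftrightarrow> f x < t" for x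
    by (auto simp: g_def zero_less_mult_iff mult_less_0_iff)
  have "h * D = h * (LINT x|M. deg x * \<bar>g x * \<bar>g x\<bar>\<bar>)"
    by (simp add: D_def abs_mult power2_eq_square)
  also have "\<dots> \<le> (LINT p|?P. wt p * \<bar>g (fst p) * \<bar>g (fst p)\<bar> - g (snd p) * \<bar>g (snd p)\<bar>\<bar>)"
    by (rule coarea_le[where B = "C\<^sup>2"]) (use C3 h t sgn in auto)
  also have "\<dots> \<le> (LINT p|?P. 2 / h * (wt p * \<bar>g (fst p) - g (snd p)\<bar>\<^sup>2)
      + h / 4 * (wt p * (g (fst p))\<^sup>2) + h / 4 * (wt p * (g (snd p))\<^sup>2))"
  proof (rule integral_mono)
    show "integrable ?P (\<lambda>p. wt p * \<bar>g (fst p) * \<bar>g (fst p)\<bar> - g (snd p) * \<bar>g (snd p)\<bar>\<bar>)"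
    proof (rule integrable_wt_mult[where B = "C\<^sup>2 + C\<^sup>2"])
      fix p assume "p \<in> space ?P"
      then show "\<bar>\<bar>g (fst p) * \<bar>g (fst p)\<bar> - g (snd p) * \<bar>g (snd p)\<bar>\<bar>\<bar> \<le> C\<^sup>2 + C\<^sup>2"
        using C3[of "fst p"] C3[of "snd p"] by (auto simp: space_pair_measure)
    qed measurable
    show "integrable ?P (\<lambda>p. 2 / h * (wt p * \<bar>g (fst p) - g (snd p)\<bar>\<^sup>2)
      + h / 4 * (wt p * (g (fst p))\<^sup>2) + h / 4 * (wt p * (g (snd p))\<^sup>2))"
      using dg C2
      by (intro Bochner_Integration.integrable_add integrable_mult_right
        integrable_wt_mult[where B = "C\<^sup>2"] integrable_wt_mult[where B = "(C + C)\<^sup>2"])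
        (auto simp: space_pair_measure)
    fix p assume p: "p \<in> space ?P"
    define a where "a = \<bar>g (fst p) - g (snd p)\<bar>"
    define b where "b = \<bar>g (fst p)\<bar> + \<bar>g (snd p)\<bar>"
    \<comment> \<open>This square encodes AM-GM with weights \<open>2/h\<close> and
      \<open>h/8\<close>. The bound of \<open>b^2\<close> by twice the sum of squares then turns
      \<open>h/8\<close> into \<open>h/4\<close> for each endpoint.\<close>
    have "0 \<le> (4 * a - h * b)\<^sup>2 / (8 * h)" using hpos by simp
    also have "\<dots> = 2 / h * a\<^sup>2 + h / 8 * b\<^sup>2 - a * b"
      using hpos by (simp add: field_simps power2_eq_square)
    finally have "a * b \<le> 2 / h * a\<^sup>2 + h / 8 * b\<^sup>2" by simp
    also have "b\<^sup>2 \<le> 2 * (g (fst p))\<^sup>2 + 2 * (g (snd p))\<^sup>2"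
      using sum_squares_bound[of "\<bar>g (fst p)\<bar>" "\<bar>g (snd p)\<bar>"] by (simp add: b_def power2_sum)
    finally have ab: "a * b \<le> 2 / h * a\<^sup>2 + h / 4 * (g (fst p))\<^sup>2 + h / 4 * (g (snd p))\<^sup>2"
      using hpos by (simp add: algebra_simps)
    have "\<bar>g (fst p) * \<bar>g (fst p)\<bar> - g (snd p) * \<bar>g (snd p)\<bar>\<bar> \<le> a * b"
      unfolding a_def b_def by (rule abs_diff_mult_abs_le)
    with ab have "wt p * \<bar>g (fst p) * \<bar>g (fst p)\<bar> - g (snd p) * \<bar>g (snd p)\<bar>\<bar>
        \<le> wt p * (2 / h * a\<^sup>2 + h / 4 * (g (fst p))\<^sup>2 + h / 4 * (g (snd p))\<^sup>2)"
      using wt_nonneg[OF p] by (intro mult_left_mono) auto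
    then show "wt p * \<bar>g (fst p) * \<bar>g (fst p)\<bar> - g (snd p) * \<bar>g (snd p)\<bar>\<bar>
        \<le> 2 / h * (wt p * \<bar>g (fst p) - g (snd p)\<bar>\<^sup>2)
          + h / 4 * (wt p * (g (fst p))\<^sup>2) + h / 4 * (wt p * (g (snd p))\<^sup>2)"
      by (simp add: a_def algebra_simps)
  qed
  also have "\<dots> = 2 / h * ?E + h / 4 * D + h / 4 * D"
  proof -
    have i: "integrable ?P (\<lambda>p. wt p * \<bar>g (fst p) - g (snd p)\<bar>\<^sup>2)"
      by (rule integrable_wt_mult[where B = "(C + C)\<^sup>2"]) (use dg in auto)
    have j: "integrable ?P (\<lambda>p. wt p * (g (fst p))\<^sup>2)" "integrable ?P (\<lambda>p. wt p * (g (snd p))\<^sup>2)"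
      by (rule integrable_wt_mult[where B = "C\<^sup>2"]; use C2 in \<open>auto simp: space_pair_measure\<close>)+
    have "(LINT p|?P. wt p * (g (fst p))\<^sup>2) = D" "(LINT p|?P. wt p * (g (snd p))\<^sup>2) = D"
      unfolding D_def
      by (rule integral_deg_fst[where B = "C\<^sup>2"] integral_deg_snd[where B = "C\<^sup>2"]; use C2 in simp)+
    then show ?thesis
      unfolding E using i j by (simp only: Bochner_Integration.integral_add Bochner_Integration.integrable_add
        integrable_mult_right integral_mult_right_zero)
  qed
  \<comment> \<open>The two \<open>g^2\<close> terms total \<open>h D / 2\<close> and are absorbed
    on the left; multiplying by \<open>h / 2\<close> then yields the constant 1/4.\<close>
  finally have "h * D / 2 \<le> 2 / h * ?E" by linarith
  then have "h / 2 * (h * D / 2) \<le> h / 2 * (2 / h * ?E)"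
    using hpos by (intro mult_left_mono) auto
  then have "h\<^sup>2 / 4 * D \<le> ?E"
    using hpos by (simp add: power2_eq_square)
  moreover have "h\<^sup>2 / 4 * degree_variance M W f \<le> h\<^sup>2 / 4 * D"
    using degree_variance_le[of f t] by (intro mult_left_mono) (auto simp: D_def g_def)
  ultimately show ?thesis by simp
qed

section \<open>Passage to the extended-real constants\<close>

text \<open>Clearing the denominator extends the bound to all measurable \<open>S\<close>: if one
  side has volume zero, the minimum vanishes and only \<open>cut_nonneg\<close> is needed.\<close>

lemma cheeger_const_le:
  assumes h: "ereal h \<le> cheeger_const M W" and S: "S \<in> sets M"
  shows "h * min (vol M W S) (vol M W (space M - S)) \<le> cut M W S"
proof (cases "vol M W S * vol M W (space M - S) > 0")
  case True
  then have m: "0 < min (vol M W S) (vol M W (space M - S))"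
    using S vol_nonneg[of S] vol_nonneg[of "space M - S"] by (auto simp: zero_less_mult_iff)
  note h
  also have "cheeger_const M W \<le> ereal (cut M W S / min (vol M W S) (vol M W (space M - S)))"
    unfolding cheeger_const_def using True S by (intro INF_lower) auto
  finally show ?thesis using m by (simp add: pos_le_divide_eq)
next
  case False
  then have "min (vol M W S) (vol M W (space M - S)) = 0"
    using S vol_nonneg[of S] vol_nonneg[of "space M - S"] by (auto simp: zero_less_mult_iff min_def)
  then show ?thesis using S by (simp add: cut_nonneg)
qed

lemma cheeger_const_nonneg: "0 \<le> cheeger_const M W"
  unfolding cheeger_const_def
  by (rule INF_greatest) (auto intro!: divide_nonneg_nonneg cut_nonneg vol_nonneg)

lemma lambda2_ge: "(cheeger_const M W)\<^sup>2 / 4 \<le> lambda2 M W"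
  unfolding lambda2_def
proof (rule INF_greatest, clarify)
  fix f assume f: "f \<in> borel_measurable M" "bounded (f ` space M)" and v: "0 < degree_variance M W f"
  let ?q = "dirichlet_energy M W f / degree_variance M W f"
  obtain B where B: "\<And>x. x \<in> space M \<Longrightarrow> \<bar>f x\<bar> \<le> B"
    using f(2) by (auto simp: bounded_iff)
  have q: "h\<^sup>2 / 4 \<le> ?q" if "0 \<le> h" "ereal h \<le> cheeger_const M W" for h
    using energy_ge[OF f(1) B that(1) cheeger_const_le[OF that(2)]] v by (simp add: pos_le_divide_eq)
  show "(cheeger_const M W)\<^sup>2 / 4 \<le> ereal ?q"
  proof (cases "cheeger_const M W")
    case (real r)
    then show ?thesis using q[of r] cheeger_const_nonneg by simp
  next
    \<comment> \<open>Now every real \<open>h >= 0\<close> is admissible. Choosing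
      \<open>h = 2 (q + 1)\<close> for the quotient \<open>q\<close> gives
      \<open>h^2 / 4 = (q + 1)^2 > q\<close>, a contradiction, so no test function exists in this
      case.\<close>
    case PInf
    have "0 \<le> ?q" using q[of 0] PInf by simp
    have z: "z < (2 * (z + 1))\<^sup>2 / 4" if "0 \<le> z" for z :: real
    proof -
      have "(2 * (z + 1))\<^sup>2 / 4 = z\<^sup>2 + 2 * z + 1" by (simp add: power2_eq_square algebra_simps)
      with that zero_le_power2[of z] show ?thesis by linarith
    qed
    have "(2 * (?q + 1))\<^sup>2 / 4 \<le> ?q"
      using \<open>0 \<le> ?q\<close> PInf by (intro q) auto
    with z[OF \<open>0 \<le> ?q\<close>] show ?thesis by linarith
  next
    case MInf
    then show ?thesis using cheeger_const_nonneg by simp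
  qed
qed

end

theorem corollary5p3:
  fixes M :: "'a measure" and W :: "'a \<Rightarrow> 'a \<Rightarrow> real"
  assumes "finite_measure M"
    and "measure M (space M) > 0"
    and "L2_graphon M W"
  shows "(cheeger_const M W)\<^sup>2 / 4 \<le> lambda2 M W \<and> lambda2 M W \<le> 2 * cheeger_const M W"
proof -
  interpret graphon M W
    using assms by (simp add: graphon_def graphon_axioms_def)
  show ?thesis using lambda2_ge lambda2_le by simp
qed

end
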